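(* Let $G$ be a connected unicyclic graph. Suppose that a trimmed form $\breve{G}$ of $G$ is obtained from $G$ by a sequence of $n_1$ deletions of appropriate vertices, $n_2$ deletions of isolated paths, and $n_3$ deletions of peripheral leaves. Then: (i) if $\breve{G}$ is a partial sun, obtained from a cycle $C$ by appending one leaf to each vertex of a set $U\subseteq V(C)$, then ${\rm gp}(G)\geq \max\{2,|U|\}+n_2-n_1$; (ii) if $\breve{G}$ is the empty graph, then $n_2-n_1\leq \ell(G)$, where $\ell(G)$ is the number of pendent vertices (vertices of degree $1$) of $G$.
   Context: All graphs are finite and simple; a unicyclic graph is a connected graph with as many edges as vertices. A vertex $x$ of a graph $H$ is appropriate if $H-x$ has at least two connected components that are paths, each joined to $x$ in $H$ at only one of its endpoints. A vertex $x$ is a peripheral leaf if $x$ is adjacent to exactly one other vertex $y$ and $y$ has at most two neighbors. Deleting an appropriate vertex means removing that vertex; deleting an isolated path means removing a connected component that is a path; deleting a peripheral leaf means removing that vertex. The trimmed form $\breve{G}$ of $G$ is the induced subgraph obtained from $G$ by a sequence of such deletions performed until no further such deletion is possible (it is unique, and for unicyclic $G$ it is either the empty graph or a partial sun). A partial sun is a graph obtained from a cycle $C_n$ by appending one pendent vertex (leaf) to each vertex of some subset $U\subseteq V(C_n)$. A set $R\subseteq V(G)$ is a general position set if no three vertices of $R$ lie on a common shortest path of $G$; ${\rm gp}(G)$ is the maximum size of a general position set of $G$. *)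

theory Defs
  imports Main
begin

text \<open>A graph is a pair of a vertex set and a set of edges, each edge being a two-element
  set of vertices. Well-formedness (finite, simple) is the predicate \<open>fin_sgraph\<close>.\<close>

type_synonym 'a graph = "'a set \<times> 'a set set"

abbreviation verts :: "'a graph \<Rightarrow> 'a set" where "verts G \<equiv> fst G"
abbreviation edges :: "'a graph \<Rightarrow> 'a set set" where "edges G \<equiv> snd G"

definition fin_sgraph :: "'a graph \<Rightarrow> bool" where
  "fin_sgraph G \<longleftrightarrow> finite (verts G) \<and> (\<forall>e\<in>edges G. e \<subseteq> verts G \<and> card e = 2)"

definition nbrs :: "'a graph \<Rightarrow> 'a \<Rightarrow> 'a set" where
  "nbrs G x = {y. {x, y} \<in> edges G}"

definition induced :: "'a graph \<Rightarrow> 'a set \<Rightarrow> 'a graph" where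
  "induced G S = (verts G \<inter> S, {e \<in> edges G. e \<subseteq> S})"

definition delete :: "'a graph \<Rightarrow> 'a set \<Rightarrow> 'a graph" where
  "delete G S = induced G (verts G - S)"

definition walk :: "'a graph \<Rightarrow> 'a list \<Rightarrow> bool" where
  "walk G p \<longleftrightarrow> p \<noteq> [] \<and> set p \<subseteq> verts G \<and> successively (\<lambda>u v. {u, v} \<in> edges G) p"

definition path :: "'a graph \<Rightarrow> 'a list \<Rightarrow> bool" where
  "path G p \<longleftrightarrow> walk G p \<and> distinct p"

definition reachable :: "'a graph \<Rightarrow> 'a \<Rightarrow> 'a \<Rightarrow> bool" where
  "reachable G u v \<longleftrightarrow> (\<exists>p. walk G p \<and> hd p = u \<and> last p = v)"

definition connected_graph :: "'a graph \<Rightarrow> bool" where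
  "connected_graph G \<longleftrightarrow> verts G \<noteq> {} \<and> (\<forall>u\<in>verts G. \<forall>v\<in>verts G. reachable G u v)"

text \<open>Connected components, as vertex sets.\<close>

definition components :: "'a graph \<Rightarrow> 'a set set" where
  "components G = (\<lambda>u. {v. reachable G u v}) ` verts G"

definition unicyclic :: "'a graph \<Rightarrow> bool" where
  "unicyclic G \<longleftrightarrow> fin_sgraph G \<and> connected_graph G \<and> card (edges G) = card (verts G)"

definition pendent_vertices :: "'a graph \<Rightarrow> 'a set" where
  "pendent_vertices G = {x \<in> verts G. card (nbrs G x) = 1}"

text \<open>The graph \<open>H\<close> is the path whose vertices, in order along the path, are \<open>p\<close>;
  its endpoints are \<open>hd p\<close> and \<open>last p\<close>. A single vertex counts as a path.\<close>

definition path_graph_along :: "'a graph \<Rightarrow> 'a list \<Rightarrow> bool" where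
  "path_graph_along H p \<longleftrightarrow> p \<noteq> [] \<and> distinct p \<and>
     H = (set p, {{p ! i, p ! Suc i} | i. Suc i < length p})"

definition is_path_graph :: "'a graph \<Rightarrow> bool" where
  "is_path_graph H \<longleftrightarrow> (\<exists>p. path_graph_along H p)"

definition is_cycle_graph :: "'a graph \<Rightarrow> bool" where
  "is_cycle_graph H \<longleftrightarrow> (\<exists>c. length c \<ge> 3 \<and> distinct c \<and>
     H = (set c, {{c ! i, c ! (Suc i mod length c)} | i. i < length c}))"

text \<open>The function \<open>leaf\<close> chooses the new pendent vertex appended at each vertex of \<open>U\<close>.\<close>

definition partial_sun :: "'a graph \<Rightarrow> 'a graph \<Rightarrow> 'a set \<Rightarrow> bool" where
  "partial_sun H C U \<longleftrightarrow> is_cycle_graph C \<and> U \<subseteq> verts C \<and>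
     (\<exists>leaf. inj_on leaf U \<and> leaf ` U \<inter> verts C = {} \<and>
        H = (verts C \<union> leaf ` U, edges C \<union> {{u, leaf u} | u. u \<in> U}))"

text \<open>\<open>P\<close> is a component of \<open>H - x\<close> that is a path and whose only vertex adjacent to \<open>x\<close> is
  an endpoint. Taking this endpoint to be \<open>hd p\<close> is no restriction, as \<open>p\<close> may be reversed.\<close>

definition path_component_joined_at_end :: "'a graph \<Rightarrow> 'a \<Rightarrow> 'a set \<Rightarrow> bool" where
  "path_component_joined_at_end H x P \<longleftrightarrow> P \<in> components (delete H {x}) \<and>
     (\<exists>p. path_graph_along (induced H P) p \<and> nbrs H x \<inter> P = {hd p})"

definition appropriate :: "'a graph \<Rightarrow> 'a \<Rightarrow> bool" where
  "appropriate H x \<longleftrightarrow> x \<in> verts H \<and>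
     (\<exists>P Q. P \<noteq> Q \<and> path_component_joined_at_end H x P \<and> path_component_joined_at_end H x Q)"

definition isolated_path :: "'a graph \<Rightarrow> 'a set \<Rightarrow> bool" where
  "isolated_path H P \<longleftrightarrow> P \<in> components H \<and> is_path_graph (induced H P)"

definition peripheral_leaf :: "'a graph \<Rightarrow> 'a \<Rightarrow> bool" where
  "peripheral_leaf H x \<longleftrightarrow> x \<in> verts H \<and> (\<exists>y. nbrs H x = {y} \<and> card (nbrs H y) \<le> 2)"

text \<open>\<open>trims_to G n1 n2 n3 H\<close>: the graph \<open>H\<close> results from \<open>G\<close> by some sequence, in any order, of
  \<open>n1\<close> deletions of appropriate vertices, \<open>n2\<close> of isolated paths and \<open>n3\<close> of peripheral leaves,
  each of these notions being taken in the current graph.\<close>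

inductive trims_to :: "'a graph \<Rightarrow> nat \<Rightarrow> nat \<Rightarrow> nat \<Rightarrow> 'a graph \<Rightarrow> bool" for G where
  refl: "trims_to G 0 0 0 G"
| appropriate: "trims_to G n1 n2 n3 H \<Longrightarrow> appropriate H x
    \<Longrightarrow> trims_to G (Suc n1) n2 n3 (delete H {x})"
| isolated_path: "trims_to G n1 n2 n3 H \<Longrightarrow> isolated_path H P
    \<Longrightarrow> trims_to G n1 (Suc n2) n3 (delete H P)"
| peripheral_leaf: "trims_to G n1 n2 n3 H \<Longrightarrow> peripheral_leaf H x
    \<Longrightarrow> trims_to G n1 n2 (Suc n3) (delete H {x})"

definition fully_trimmed :: "'a graph \<Rightarrow> bool" where
  "fully_trimmed H \<longleftrightarrow>
     (\<nexists>x. appropriate H x) \<and> (\<nexists>P. isolated_path H P) \<and> (\<nexists>x. peripheral_leaf H x)"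

definition trimmed_form_via :: "'a graph \<Rightarrow> nat \<Rightarrow> nat \<Rightarrow> nat \<Rightarrow> 'a graph \<Rightarrow> bool" where
  "trimmed_form_via G n1 n2 n3 H \<longleftrightarrow> trims_to G n1 n2 n3 H \<and> fully_trimmed H"

definition shortest_path :: "'a graph \<Rightarrow> 'a list \<Rightarrow> bool" where
  "shortest_path G p \<longleftrightarrow> path G p \<and>
     (\<forall>q. path G q \<and> hd q = hd p \<and> last q = last p \<longrightarrow> length p \<le> length q)"

definition general_position :: "'a graph \<Rightarrow> 'a set \<Rightarrow> bool" where
  "general_position G R \<longleftrightarrow> R \<subseteq> verts G \<and>
     \<not> (\<exists>x\<in>R. \<exists>y\<in>R. \<exists>z\<in>R. x \<noteq> y \<and> y \<noteq> z \<and> x \<noteq> z \<and>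
          (\<exists>p. shortest_path G p \<and> {x, y, z} \<subseteq> set p))"

definition gp :: "'a graph \<Rightarrow> nat" where
  "gp G = Max (card ` {R. general_position G R})"

end

theory Submission
  imports Defs
begin

text \<open>Half of the sum of \<open>\<bar>deg v - 2\<bar>\<close> over all vertices drops by at least one when an isolated path
  is deleted, does not grow when a leaf is deleted, and grows by at most one when a vertex of
  degree at least two is deleted. For a unicyclic graph the sum of \<open>deg v - 2\<close> vanishes, so this
  quantity is the number of leaves; hence \<open>n2 - n1\<close> is at most the number of leaves.

  When a cycle survives the trimming, one may moreover subtract the number of cycle vertices of
  degree at least three: such a vertex loses this status when its degree drops from three to two,
  but then \<open>\<bar>deg v - 2\<bar>\<close> drops instead of growing. The corrected quantity vanishes on a partial sun,
  so \<open>n2 - n1\<close> is at most the number of leaves minus the number of branching cycle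
  vertices. The leaves are in general position, and if only one cycle vertex branches, then any
  other cycle vertex can be added to them.\<close>

subsection \<open>Neighbourhoods and degrees\<close>

lemma nbrs_sym: "y \<in> nbrs G x \<longleftrightarrow> x \<in> nbrs G y"
  by (simp add: nbrs_def insert_commute)

lemma nbrs_subset_verts: "fin_sgraph G \<Longrightarrow> nbrs G x \<subseteq> verts G"
  by (auto simp: nbrs_def fin_sgraph_def)

lemma finite_nbrs: "fin_sgraph G \<Longrightarrow> finite (nbrs G x)"
  by (meson fin_sgraph_def finite_subset nbrs_subset_verts)

lemma not_self_nbr: "fin_sgraph G \<Longrightarrow> x \<notin> nbrs G x"
  by (auto simp: nbrs_def fin_sgraph_def)

lemma finite_edges: "fin_sgraph G \<Longrightarrow> finite (edges G)"
  by (rule finite_subset[of _ "Pow (verts G)"]) (auto simp: fin_sgraph_def)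

lemma card_nbrs_eq_card_incident:
  assumes "fin_sgraph G"
  shows "card (nbrs G v) = card {e \<in> edges G. v \<in> e}"
proof (rule bij_betw_same_card[of "\<lambda>y. {v, y}"])
  have "inj_on (\<lambda>y. {v, y}) (nbrs G v)"
    by (auto simp: inj_on_def doubleton_eq_iff)
  moreover have "(\<lambda>y. {v, y}) ` nbrs G v = {e \<in> edges G. v \<in> e}"
  proof
    show "{e \<in> edges G. v \<in> e} \<subseteq> (\<lambda>y. {v, y}) ` nbrs G v"
    proof
      fix e assume e: "e \<in> {e \<in> edges G. v \<in> e}"
      then have "card e = 2" using assms by (auto simp: fin_sgraph_def)
      then obtain a b where "e = {a, b}" by (auto simp: card_2_iff)
      then show "e \<in> (\<lambda>y. {v, y}) ` nbrs G v"
        using e by (auto simp: nbrs_def insert_commute image_iff)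
    qed
  qed (auto simp: nbrs_def)
  ultimately show "bij_betw (\<lambda>y. {v, y}) (nbrs G v) {e \<in> edges G. v \<in> e}"
    by (simp add: bij_betw_def)
qed

text \<open>Double counting of incident pairs of a vertex and an edge.\<close>

lemma handshake:
  assumes "fin_sgraph G"
  shows "(\<Sum>v\<in>verts G. card (nbrs G v)) = 2 * card (edges G)"
proof -
  have "(\<Sum>v\<in>verts G. card {e \<in> edges G. v \<in> e}) = 2 * card (edges G)"
  proof (rule sum_multicount)
    show "\<forall>e\<in>edges G. card {v \<in> verts G. v \<in> e} = 2"
    proof
      fix e assume "e \<in> edges G"
      then have "{v \<in> verts G. v \<in> e} = e" "card e = 2"
        using assms by (auto simp: fin_sgraph_def)
      then show "card {v \<in> verts G. v \<in> e} = 2" by simp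
    qed
  qed (use assms finite_edges[OF assms] in \<open>auto simp: fin_sgraph_def\<close>)
  then show ?thesis by (simp add: card_nbrs_eq_card_incident[OF assms])
qed

lemma fin_sgraph_induced: "fin_sgraph G \<Longrightarrow> fin_sgraph (induced G S)"
  by (auto simp: fin_sgraph_def induced_def)

lemma verts_delete: "verts (delete G S) = verts G - S"
  by (auto simp: delete_def induced_def)

lemma nbrs_delete:
  "fin_sgraph G \<Longrightarrow> v \<notin> S \<Longrightarrow> nbrs (delete G S) v = nbrs G v - S"
  by (auto simp: delete_def induced_def nbrs_def fin_sgraph_def)

lemma fin_sgraph_delete: "fin_sgraph G \<Longrightarrow> fin_sgraph (delete G S)"
  by (simp add: delete_def fin_sgraph_induced)

subsection \<open>Components\<close>

lemma reachable_sym: "reachable G u v \<Longrightarrow> reachable G v u"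
proof -
  assume "reachable G u v"
  then obtain p where p: "walk G p" "hd p = u" "last p = v"
    by (auto simp: reachable_def)
  then have "walk G (rev p)"
    by (simp add: walk_def insert_commute)
  moreover have "hd (rev p) = v" "last (rev p) = u"
    using p by (simp_all add: hd_rev last_rev)
  ultimately show ?thesis unfolding reachable_def by blast
qed

lemma reachable_trans:
  assumes "reachable G u v" "reachable G v w"
  shows "reachable G u w"
proof -
  obtain p q where p: "walk G p" "hd p = u" "last p = v"
    and q: "walk G q" "hd q = v" "last q = w"
    using assms by (auto simp: reachable_def)
  obtain q' where q': "q = v # q'"
    using q by (cases q) (auto simp: walk_def)
  have "successively (\<lambda>a b. {a, b} \<in> edges G) (p @ q')"
    using p q unfolding q' walk_def successively_append_iff
    by (auto simp add: successively_Cons)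
  then have "walk G (p @ q')" using p(1) q(1) by (simp add: q' walk_def)
  moreover have "last (p @ q') = w" using p(3) q(3) by (cases q') (simp_all add: q')
  moreover have "hd (p @ q') = u" using p(1,2) by (simp add: walk_def)
  ultimately show ?thesis unfolding reachable_def by blast
qed

lemma reachable_edge:
  assumes "fin_sgraph G" "{u, v} \<in> edges G"
  shows "reachable G u v"
  unfolding reachable_def
  by (rule exI[of _ "[u, v]"]) (use assms in \<open>auto simp: walk_def fin_sgraph_def\<close>)

text \<open>Reachability is symmetric and transitive, so every member can serve as the root;
  components sharing a vertex therefore coincide.\<close>

lemma component_eq:
  assumes "P \<in> components G" "v \<in> P"
  shows "P = {w. reachable G v w}"
proof -
  obtain u where "P = {w. reachable G u w}" using assms(1) unfolding components_def by blast
  then show ?thesis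
    using assms(2) reachable_sym[of G u v] reachable_trans[of G u v] reachable_trans[of G v u]
    by blast
qed

lemma component_subset_verts: "P \<in> components G \<Longrightarrow> P \<subseteq> verts G"
  by (fastforce simp: components_def reachable_def walk_def dest: last_in_set)

lemma nbrs_subset_component:
  assumes "fin_sgraph G" "P \<in> components G" "v \<in> P"
  shows "nbrs G v \<subseteq> P"
  using component_eq[OF assms(2,3)] reachable_edge[OF assms(1)] by (auto simp: nbrs_def)

text \<open>Distinct components are disjoint, so the contact vertices \<open>a\<close> and
  \<open>b\<close> are two different neighbours of \<open>x\<close>.\<close>

lemma appropriate_degree:
  assumes "fin_sgraph G" "appropriate G x"
  shows "2 \<le> card (nbrs G x)"
proof -
  obtain P Q a b where "P \<noteq> Q"
    and P: "P \<in> components (delete G {x})" "nbrs G x \<inter> P = {a}"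
    and Q: "Q \<in> components (delete G {x})" "nbrs G x \<inter> Q = {b}"
    using assms(2) unfolding appropriate_def path_component_joined_at_end_def by blast
  have "a \<in> P" "b \<in> Q" using P Q by auto
  then have "a \<noteq> b"
    using component_eq[OF P(1), of a] component_eq[OF Q(1), of a] \<open>P \<noteq> Q\<close> by metis
  moreover have "{a, b} \<subseteq> nbrs G x" using P Q by auto
  ultimately show ?thesis
    using card_mono[OF finite_nbrs[OF assms(1)], of "{a, b}" x] by simp
qed

subsection \<open>The potential\<close>

text \<open>Everything is doubled to stay within the integers: the correction is 2 per branching
  vertex of \<open>C\<close>, so a vertex of \<open>C\<close> of degree 3 has weight -1. Taking
  \<open>C\<close> empty gives the uncorrected version.\<close>

definition weight :: "'a set \<Rightarrow> 'a \<Rightarrow> nat \<Rightarrow> int" where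
  "weight C v d = \<bar>int d - 2\<bar> - (if v \<in> C \<and> d \<ge> 3 then 2 else 0)"

definition potential :: "'a set \<Rightarrow> 'a graph \<Rightarrow> int" where
  "potential C G = (\<Sum>v\<in>verts G. weight C v (card (nbrs G v)))"

lemma weight_notin: "v \<notin> C \<Longrightarrow> weight C v d = \<bar>int d - 2\<bar>"
  by (simp add: weight_def)

text \<open>The correction can be lost only when the degree drops from 3 to 2, and there the weight
  goes from -1 to 0.\<close>

lemma weight_diff_one: "d \<ge> 1 \<Longrightarrow> weight C v (d - 1) \<le> weight C v d + 1"
  by (auto simp: weight_def)

text \<open>Each of the \<open>d\<close> neighbours gains at most 1, while the weight of
  \<open>x\<close> itself disappears. The growth is thus at most 0 for \<open>d = 1\<close> and at
  most 2 for \<open>d \<ge> 2\<close>.\<close>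

lemma potential_delete_vertex:
  assumes G: "fin_sgraph G" and x: "x \<in> verts G" "x \<notin> C"
  defines "d \<equiv> int (card (nbrs G x))"
  shows "potential C (delete G {x}) \<le> potential C G - \<bar>d - 2\<bar> + d"
proof -
  have fin: "finite (verts G)" using G by (simp add: fin_sgraph_def)
  have nb: "nbrs G x \<subseteq> verts G - {x}"
    using nbrs_subset_verts[OF G] not_self_nbr[OF G] by blast
  have "potential C (delete G {x})
      = (\<Sum>v\<in>verts G - {x}. weight C v (card (nbrs (delete G {x}) v)))"
    by (simp add: potential_def verts_delete)
  also have "\<dots> \<le> (\<Sum>v\<in>verts G - {x}. weight C v (card (nbrs G v))
        + (if v \<in> nbrs G x then 1 else 0))"
  proof (rule sum_mono)
    fix v assume v: "v \<in> verts G - {x}"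
    then have *: "nbrs (delete G {x}) v = nbrs G v - {x}"
      using nbrs_delete[OF G] by auto
    show "weight C v (card (nbrs (delete G {x}) v))
        \<le> weight C v (card (nbrs G v)) + (if v \<in> nbrs G x then 1 else 0)"
    proof (cases "v \<in> nbrs G x")
      case True
      then have "x \<in> nbrs G v" by (simp add: nbrs_sym)
      then have "card (nbrs G v - {x}) = card (nbrs G v) - 1" "card (nbrs G v) \<ge> 1"
        using finite_nbrs[OF G] by (auto simp: card_gt_0_iff Suc_le_eq)
      then show ?thesis using True * weight_diff_one by simp
    next
      case False
      then have "x \<notin> nbrs G v" by (simp add: nbrs_sym)
      then show ?thesis using False * by simp
    qed
  qed
  also have "\<dots> = (\<Sum>v\<in>verts G - {x}. weight C v (card (nbrs G v)))
      + (\<Sum>v\<in>verts G - {x}. if v \<in> nbrs G x then 1 else 0)"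
    by (rule sum.distrib)
  also have "(\<Sum>v\<in>verts G - {x}. if v \<in> nbrs G x then 1 else (0::int)) = d"
  proof -
    have "(\<Sum>v\<in>verts G - {x}. if v \<in> nbrs G x then 1 else (0::int))
        = (\<Sum>v\<in>(verts G - {x}) \<inter> nbrs G x. 1)"
      using fin by (intro sum.inter_restrict[symmetric]) auto
    also have "(verts G - {x}) \<inter> nbrs G x = nbrs G x" using nb by blast
    finally show ?thesis by (simp add: d_def)
  qed
  also have "(\<Sum>v\<in>verts G - {x}. weight C v (card (nbrs G v))) = potential C G - \<bar>d - 2\<bar>"
    using x fin by (simp add: potential_def sum_diff1 weight_notin d_def)
  finally show ?thesis by simp
qed

text \<open>A component has no edges leaving it, so degrees outside \<open>P\<close> are unchanged
  and exactly the weight on \<open>P\<close> is lost. That weight is at least the sum of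
  \<open>2 - deg\<close>, which is twice the number of vertices minus twice the number of edges,
  hence at least 2 on a path.\<close>

lemma potential_delete_isolated_path:
  assumes G: "fin_sgraph G" and P: "isolated_path G P" and disj: "P \<inter> C = {}"
  shows "potential C (delete G P) + 2 \<le> potential C G"
proof -
  have comp: "P \<in> components G" using P by (simp add: isolated_path_def)
  note sub = component_subset_verts[OF comp]
  have fin: "finite (verts G)" using G by (simp add: fin_sgraph_def)
  obtain p where p: "p \<noteq> []" "distinct p"
    "induced G P = (set p, {{p ! i, p ! Suc i} | i. Suc i < length p})"
    using P by (auto simp: isolated_path_def is_path_graph_def path_graph_along_def)
  have verts: "verts (induced G P) = P" using sub by (auto simp: induced_def)
  have "edges (induced G P) = (\<lambda>i. {p ! i, p ! Suc i}) ` {..<length p - 1}"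
    unfolding p(3) by auto
  then have "card (edges (induced G P)) \<le> length p - 1"
    using card_image_le[of "{..<length p - 1}" "\<lambda>i. {p ! i, p ! Suc i}"] by simp
  moreover have "length p = card P"
    using p(2) verts distinct_card[of p] unfolding p(3) by simp
  moreover have "length p \<ge> 1" using p(1) by (cases p) auto
  ultimately have edges: "card (edges (induced G P)) + 1 \<le> card P" by linarith
  have nbrs: "nbrs (induced G P) v = nbrs G v" if "v \<in> P" for v
    using nbrs_subset_component[OF G comp that] that by (auto simp: nbrs_def induced_def)
  have "(\<Sum>v\<in>P. card (nbrs G v)) = 2 * card (edges (induced G P))"
    using handshake[OF fin_sgraph_induced[OF G], of P] by (simp add: verts nbrs)
  then have "2 \<le> (\<Sum>v\<in>P. 2 - int (card (nbrs G v)))"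
    using edges by (simp add: sum_subtractf flip: of_nat_sum)
  also have "\<dots> \<le> (\<Sum>v\<in>P. weight C v (card (nbrs G v)))"
    using disj by (intro sum_mono) (auto simp: weight_notin disjoint_iff)
  finally have "2 \<le> (\<Sum>v\<in>P. weight C v (card (nbrs G v)))" .
  moreover have "potential C (delete G P) = (\<Sum>v\<in>verts G - P. weight C v (card (nbrs G v)))"
    unfolding potential_def verts_delete
  proof (rule sum.cong)
    fix v assume v: "v \<in> verts G - P"
    then have "nbrs G v \<inter> P = {}"
      using nbrs_subset_component[OF G comp] nbrs_sym[of _ G v] by blast
    then have "nbrs (delete G P) v = nbrs G v"
      using v nbrs_delete[OF G, of v P] by blast
    then show "weight C v (card (nbrs (delete G P) v)) = weight C v (card (nbrs G v))" by simp
  qed simp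
  moreover have "potential C G = (\<Sum>v\<in>verts G - P. weight C v (card (nbrs G v)))
      + (\<Sum>v\<in>P. weight C v (card (nbrs G v)))"
    unfolding potential_def using sub fin by (rule sum.subset_diff)
  ultimately show ?thesis by linarith
qed

lemma trims_to_subgraph:
  fixes G :: "'a graph"
  assumes "trims_to G n1 n2 n3 H" "fin_sgraph G"
  shows "fin_sgraph H \<and> verts H \<subseteq> verts G \<and> edges H \<subseteq> edges G"
proof -
  have "edges (delete K S) \<subseteq> edges K" for K :: "'a graph" and S
    by (auto simp: delete_def induced_def)
  then show ?thesis
    using assms(2) by (induction rule: trims_to.induct[OF assms(1)])
      (simp_all add: fin_sgraph_delete verts_delete, blast+)
qed

text \<open>Since \<open>C\<close> survives to the end, no deletion along the way touches it. Per
  step the potential rises by at most 2, falls by at least 2, or does not rise, for the three kinds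
  of deletion respectively.\<close>

lemma trims_to_potential:
  assumes "trims_to G n1 n2 n3 H" "fin_sgraph G" "C \<subseteq> verts H"
  shows "potential C H + 2 * int n2 \<le> potential C G + 2 * int n1"
  using assms
proof (induction rule: trims_to.induct)
  case refl
  then show ?case by simp
next
  case (appropriate n1 n2 n3 H x)
  have H: "fin_sgraph H" using trims_to_subgraph[OF appropriate.hyps(1) assms(2)] by blast
  have "C \<subseteq> verts H" using appropriate.prems by (auto simp: verts_delete)
  note IH = appropriate.IH[OF assms(2) this]
  have "x \<in> verts H" "x \<notin> C"
    using appropriate by (auto simp: appropriate_def verts_delete)
  then have "potential C (delete H {x}) \<le> potential C H + 2"
    using potential_delete_vertex[OF H, of x C] appropriate_degree[OF H appropriate.hyps(2)]
    by simp
  then show ?case using IH by simp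
next
  case (isolated_path n1 n2 n3 H P)
  have H: "fin_sgraph H" using trims_to_subgraph[OF isolated_path.hyps(1) assms(2)] by blast
  have "C \<subseteq> verts H" using isolated_path.prems by (auto simp: verts_delete)
  note IH = isolated_path.IH[OF assms(2) this]
  have "P \<inter> C = {}" using isolated_path by (auto simp: verts_delete)
  then show ?case
    using potential_delete_isolated_path[OF H isolated_path.hyps(2), of C] IH by simp
next
  case (peripheral_leaf n1 n2 n3 H x)
  have H: "fin_sgraph H" using trims_to_subgraph[OF peripheral_leaf.hyps(1) assms(2)] by blast
  have "C \<subseteq> verts H" using peripheral_leaf.prems by (auto simp: verts_delete)
  note IH = peripheral_leaf.IH[OF assms(2) this]
  have "x \<in> verts H" "x \<notin> C" "card (nbrs H x) = 1"
    using peripheral_leaf by (auto simp: peripheral_leaf_def verts_delete)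
  then have "potential C (delete H {x}) \<le> potential C H"
    using potential_delete_vertex[OF H, of x C] by simp
  then show ?case using IH by simp
qed

subsection \<open>Unicyclic graphs and partial suns\<close>

text \<open>The step leaving \<open>S\<close> ends at the first position from \<open>i\<close> on
  that lies outside \<open>S\<close>. The bounds on \<open>j\<close> are kept so that exits before
  and after a given position can be told apart.\<close>

lemma walk_exit:
  assumes "walk G p" "i \<le> k" "k < length p" "p ! i \<in> S" "p ! k \<notin> S"
  obtains j where "i \<le> j" "j < k" "p ! j \<in> S" "p ! Suc j \<notin> S" "p ! Suc j \<in> nbrs G (p ! j)"
proof -
  define m where "m = (LEAST m. i \<le> m \<and> p ! m \<notin> S)"
  have m: "i \<le> m" "p ! m \<notin> S" "m \<le> k"
    using LeastI[of "\<lambda>m. i \<le> m \<and> p ! m \<notin> S" k] Least_le[of "\<lambda>m. i \<le> m \<and> p ! m \<notin> S" k]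
      assms(2,5) unfolding m_def by auto
  have min: "p ! j \<in> S" if "i \<le> j" "j < m" for j
    using not_less_Least[of j "\<lambda>m. i \<le> m \<and> p ! m \<notin> S"] that unfolding m_def by blast
  have "i < m" using m(1,2) assms(4) by (metis order_le_less)
  then obtain j where j: "m = Suc j" "i \<le> j" by (cases m) auto
  have "j < k" using m(3) j(1) by simp
  have "{p ! j, p ! Suc j} \<in> edges G"
    using assms(1,3) \<open>j < k\<close> by (simp add: walk_def successively_conv_nth)
  then show ?thesis
    using that[of j] j m(2) \<open>j < k\<close> min[of j] by (simp add: nbrs_def)
qed

lemma connected_graph_exit:
  assumes "connected_graph G" "u \<in> verts G" "v \<in> verts G" "u \<in> S" "v \<notin> S"
  obtains w where "w \<in> S" "\<not> nbrs G w \<subseteq> S"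
proof -
  obtain p where p: "walk G p" "hd p = u" "last p = v"
    using assms by (auto simp: connected_graph_def reachable_def)
  have ne: "p \<noteq> []" using p(1) by (simp add: walk_def)
  have "p ! 0 \<in> S" "p ! (length p - 1) \<notin> S"
    using p(2,3) assms(4,5) ne by (simp_all add: hd_conv_nth last_conv_nth)
  then obtain j where "p ! j \<in> S" "p ! Suc j \<notin> S" "p ! Suc j \<in> nbrs G (p ! j)"
    using walk_exit[OF p(1), of 0 "length p - 1" S] ne by auto
  then show ?thesis using that by blast
qed

text \<open>There are as many edges as vertices, so some edge exists and provides a vertex other
  than \<open>v\<close>; connectedness then forces an edge out of \<open>{v}\<close>.\<close>

lemma unicyclic_degree_pos:
  assumes "unicyclic G" "v \<in> verts G"
  shows "card (nbrs G v) \<ge> 1"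
proof -
  have G: "fin_sgraph G" "connected_graph G" "card (edges G) = card (verts G)"
    using assms by (auto simp: unicyclic_def)
  have "card (verts G) > 0"
    using G(1) assms(2) by (auto simp: fin_sgraph_def card_gt_0_iff)
  then obtain e where "e \<in> edges G"
    using G(3) by fastforce
  then have "card e = 2" "e \<subseteq> verts G" using G(1) by (auto simp: fin_sgraph_def)
  then have "\<not> e \<subseteq> {v}" using card_mono[of "{v}" e] by fastforce
  then obtain u where "u \<in> verts G" "u \<notin> {v}" using \<open>e \<subseteq> verts G\<close> by blast
  then obtain w where "w \<in> {v}" "\<not> nbrs G w \<subseteq> {v}"
    using connected_graph_exit[OF G(2) assms(2), of u "{v}"] by blast
  then have "nbrs G v \<noteq> {}" by blast
  then show ?thesis using finite_nbrs[OF G(1)] by (simp add: card_gt_0_iff Suc_le_eq)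
qed

text \<open>For \<open>d \<ge> 1\<close>, the value \<open>\<bar>d - 2\<bar>\<close> is
  \<open>d - 2\<close>, plus 2 if \<open>d = 1\<close>. The terms \<open>d - 2\<close> sum to 0 by
  the handshake lemma, as edges and vertices are equally many.\<close>

lemma potential_unicyclic:
  assumes G: "unicyclic G" and "C \<subseteq> verts G"
  shows "potential C G = 2 * int (card (pendent_vertices G))
    - 2 * int (card {v \<in> C. card (nbrs G v) \<ge> 3})"
proof -
  have fg: "fin_sgraph G" "card (edges G) = card (verts G)"
    using G by (auto simp: unicyclic_def)
  have fin: "finite (verts G)" using fg by (simp add: fin_sgraph_def)
  have count: "(\<Sum>v\<in>verts G. if P v then 2 else 0) = 2 * int (card {v \<in> verts G. P v})" for P
    using fin by (simp flip: sum.inter_filter)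
  have "(\<Sum>v\<in>verts G. int (card (nbrs G v)) - 2) = 0"
    using handshake[OF fg(1)] fg(2) by (simp add: sum_subtractf flip: of_nat_sum)
  moreover have "potential C G = (\<Sum>v\<in>verts G. (int (card (nbrs G v)) - 2)
      + (if card (nbrs G v) = 1 then 2 else 0)
      - (if v \<in> C \<and> card (nbrs G v) \<ge> 3 then 2 else 0))"
    unfolding potential_def
  proof (rule sum.cong)
    fix v assume "v \<in> verts G"
    then have "card (nbrs G v) \<ge> 1" by (rule unicyclic_degree_pos[OF G])
    then show "weight C v (card (nbrs G v)) = (int (card (nbrs G v)) - 2)
      + (if card (nbrs G v) = 1 then 2 else 0)
      - (if v \<in> C \<and> card (nbrs G v) \<ge> 3 then 2 else 0)"
      by (auto simp: weight_def)
  qed simp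
  moreover have "{v \<in> verts G. v \<in> C \<and> card (nbrs G v) \<ge> 3} = {v \<in> C. card (nbrs G v) \<ge> 3}"
    using assms(2) by blast
  ultimately show ?thesis
    by (simp add: sum.distrib sum_subtractf count pendent_vertices_def)
qed

lemma cycle_degree:
  assumes "is_cycle_graph C" "v \<in> verts C"
  shows "card (nbrs C v) = 2"
proof -
  obtain c where c: "length c \<ge> 3" "distinct c"
    "C = (set c, {{c ! i, c ! (Suc i mod length c)} | i. i < length c})"
    using assms(1) by (auto simp: is_cycle_graph_def)
  define n where "n = length c"
  have n: "n \<ge> 3" using c by (simp add: n_def)
  obtain i where i: "i < n" "v = c ! i"
    using assms(2) c by (auto simp: in_set_conv_nth n_def)
  \<comment> \<open>The cyclic predecessor and successor of \<open>i\<close>; they differ because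
    \<open>n \<ge> 3\<close>.\<close>
  define j where "j = (if i = 0 then n - 1 else i - 1)"
  define k where "k = Suc i mod n"
  have jk: "j < n" "k < n" "Suc j mod n = i" "j \<noteq> k"
    using n i by (auto simp: j_def k_def mod_Suc)
  have inv: "m = j" if "m < n" "Suc m mod n = i" for m
    using that n by (auto simp: j_def mod_Suc split: if_splits)
  have eq: "c ! a = c ! b \<longleftrightarrow> a = b" if "a < n" "b < n" for a b
    using that c(2) nth_eq_iff_index_eq by (auto simp: n_def)
  have "nbrs C v = {c ! j, c ! k}"
  proof
    show "nbrs C v \<subseteq> {c ! j, c ! k}"
    proof
      fix y assume "y \<in> nbrs C v"
      then obtain m where m: "m < n" "{c ! i, y} = {c ! m, c ! (Suc m mod n)}"
        using c i by (auto simp: nbrs_def n_def)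
      have "Suc m mod n < n" using n by simp
      \<comment> \<open>Either \<open>m = i\<close>, and \<open>y\<close> is the successor, or
        \<open>i\<close> is the successor of \<open>m\<close>, and \<open>inv\<close> gives
        \<open>m = j\<close>.\<close>
      then show "y \<in> {c ! j, c ! k}"
        using m i eq inv by (auto simp: doubleton_eq_iff k_def)
    qed
    have "{v, c ! k} \<in> edges C" "{c ! j, v} \<in> edges C"
      using c i jk by (auto simp: k_def n_def)
    then show "{c ! j, c ! k} \<subseteq> nbrs C v"
      by (auto simp: nbrs_def insert_commute)
  qed
  then show ?thesis using jk eq by simp
qed

lemma nbrs_cycle_subset:
  assumes "is_cycle_graph C"
  shows "nbrs C v \<subseteq> verts C"
  using assms by (auto simp: is_cycle_graph_def nbrs_def doubleton_eq_iff)
     (metis length_pos_if_in_set mod_less_divisor nth_mem)+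

lemma finite_verts_cycle: "is_cycle_graph C \<Longrightarrow> finite (verts C)"
  by (auto simp: is_cycle_graph_def)

lemma card_verts_cycle: "is_cycle_graph C \<Longrightarrow> card (verts C) \<ge> 3"
  by (auto simp: is_cycle_graph_def distinct_card)

lemma partial_sun_degree:
  assumes "partial_sun H C U" "v \<in> verts C"
  shows "card (nbrs H v) = (if v \<in> U then 3 else 2)"
proof -
  obtain leaf where C: "is_cycle_graph C" and l: "leaf ` U \<inter> verts C = {}" "U \<subseteq> verts C"
    "edges H = edges C \<union> {{u, leaf u} | u. u \<in> U}"
    using assms(1) by (auto simp: partial_sun_def)
  have deg: "card (nbrs C v) = 2" by (rule cycle_degree[OF C assms(2)])
  then have fin: "finite (nbrs C v)" by (metis card.infinite zero_neq_numeral)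
  have "nbrs H v = nbrs C v \<union> (if v \<in> U then {leaf v} else {})"
    using l(1,2) assms(2) by (auto simp: l(3) nbrs_def doubleton_eq_iff)
  moreover have "leaf v \<notin> nbrs C v" if "v \<in> U"
    using that l(1) nbrs_cycle_subset[OF C] by blast
  ultimately show ?thesis using deg fin by auto
qed

text \<open>Each vertex of \<open>U\<close> has degree 3 and weight -1, cancelled by the weight 1 of
  its leaf; the other cycle vertices have degree 2 and weight 0.\<close>

lemma potential_partial_sun:
  assumes sun: "partial_sun H C U"
  shows "potential (verts C) H = 0"
proof -
  obtain leaf where C: "is_cycle_graph C" and l: "leaf ` U \<inter> verts C = {}" "U \<subseteq> verts C"
    "inj_on leaf U" "H = (verts C \<union> leaf ` U, edges C \<union> {{u, leaf u} | u. u \<in> U})"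
    using sun by (auto simp: partial_sun_def)
  have fin: "finite (verts C)" "finite U"
    using finite_verts_cycle[OF C] finite_subset[OF l(2)] by simp_all
  have verts_H: "verts H = verts C \<union> leaf ` U" by (simp add: l(4))
  \<comment> \<open>No cycle edge meets a leaf, and injectivity of \<open>leaf\<close> excludes a
    second attachment.\<close>
  have leaf_nbrs: "nbrs H (leaf u) = {u}" if "u \<in> U" for u
  proof -
    have "leaf u \<notin> verts C" using that l(1) by blast
    then have "leaf u \<notin> nbrs C y" for y using nbrs_cycle_subset[OF C] by blast
    then have "{leaf u, y} \<notin> edges C" for y by (simp add: nbrs_def insert_commute)
    then show ?thesis
      using that l(1-3) by (auto simp: l(4) nbrs_def doubleton_eq_iff inj_on_def)
  qed
  have "potential (verts C) H = (\<Sum>v\<in>verts C. weight (verts C) v (card (nbrs H v)))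
      + (\<Sum>v\<in>leaf ` U. weight (verts C) v (card (nbrs H v)))"
    unfolding potential_def verts_H using fin l(1) by (intro sum.union_disjoint) auto
  also have "(\<Sum>v\<in>verts C. weight (verts C) v (card (nbrs H v)))
      = (\<Sum>v\<in>verts C. if v \<in> U then -1 else 0)"
    by (rule sum.cong) (auto simp: partial_sun_degree[OF sun] weight_def)
  also have "\<dots> = (\<Sum>v\<in>verts C \<inter> U. -1)"
    by (rule sum.inter_restrict[OF fin(1), symmetric])
  also have "verts C \<inter> U = U" using l(2) by blast
  also have "(\<Sum>v\<in>leaf ` U. weight (verts C) v (card (nbrs H v))) = (\<Sum>v\<in>leaf ` U. 1)"
    by (rule sum.cong) (use l(1) in \<open>auto simp: leaf_nbrs weight_def\<close>)
  finally show ?thesis using l(3) by (simp add: card_image)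
qed

subsection \<open>General position\<close>

lemma gp_ge_card:
  assumes "fin_sgraph G" "general_position G R"
  shows "card R \<le> gp G"
  unfolding gp_def
proof (rule Max_ge)
  have "{R. general_position G R} \<subseteq> Pow (verts G)"
    by (auto simp: general_position_def)
  then show "finite (card ` {R. general_position G R})"
    using assms(1) finite_subset[of _ "Pow (verts G)"] by (simp add: fin_sgraph_def)
qed (use assms in auto)

lemma general_position_card_le_2:
  assumes "R \<subseteq> verts G" "finite R" "card R \<le> 2"
  shows "general_position G R"
proof -
  have "False" if "x \<in> R" "y \<in> R" "z \<in> R" "x \<noteq> y" "y \<noteq> z" "x \<noteq> z" for x y z
    using card_mono[OF assms(2), of "{x, y, z}"] that assms(3) by simp
  then show ?thesis using assms(1) by (auto simp: general_position_def)
qed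

text \<open>Sorting the three positions singles out a middle one; which of \<open>x\<close>,
  \<open>y\<close>, \<open>z\<close> sits there is left open by the set equation.\<close>

lemma three_on_path:
  assumes "x \<noteq> y" "y \<noteq> z" "x \<noteq> z" "{x, y, z} \<subseteq> set p"
  obtains i j k where "i < j" "j < k" "k < length p" "{p ! i, p ! j, p ! k} = {x, y, z}"
proof -
  obtain a b c where *: "a < length p" "b < length p" "c < length p"
    "x = p ! a" "y = p ! b" "z = p ! c"
    using assms(4) by (auto simp: in_set_conv_nth)
  then have ne: "a \<noteq> b" "b \<noteq> c" "a \<noteq> c" using assms by auto
  have set: "{p ! i, p ! j, p ! k} = {x, y, z}" if "{i, j, k} = {a, b, c}" for i j k
  proof -
    have "(!) p ` {i, j, k} = (!) p ` {a, b, c}" using that by simp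
    then show ?thesis using *(4-6) by simp
  qed
  consider "a < b" "b < c" | "a < c" "c < b" | "b < a" "a < c" | "b < c" "c < a"
    | "c < a" "a < b" | "c < b" "b < a"
    using ne by linarith
  then show ?thesis
  proof cases
    case 1
    then show ?thesis using *(1-3) by (intro that[of a b c] set) auto
  next
    case 2
    then show ?thesis using *(1-3) by (intro that[of a c b] set) auto
  next
    case 3
    then show ?thesis using *(1-3) by (intro that[of b a c] set) auto
  next
    case 4
    then show ?thesis using *(1-3) by (intro that[of b c a] set) auto
  next
    case 5
    then show ?thesis using *(1-3) by (intro that[of c a b] set) auto
  next
    case 6
    then show ?thesis using *(1-3) by (intro that[of c b a] set) auto
  qed
qed

lemma path_interior_degree:
  assumes "fin_sgraph G" "path G p" "0 < j" "Suc j < length p"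
  shows "card (nbrs G (p ! j)) \<ge> 2"
proof -
  obtain i where i: "j = Suc i" using assms(3) by (cases j) auto
  have "{p ! i, p ! j} \<in> edges G" "{p ! j, p ! Suc j} \<in> edges G"
    using assms i by (auto simp: path_def walk_def successively_conv_nth)
  then have "{p ! i, p ! Suc j} \<subseteq> nbrs G (p ! j)"
    by (auto simp: nbrs_def insert_commute)
  moreover have "p ! i \<noteq> p ! Suc j"
    using assms i by (simp add: path_def nth_eq_iff_index_eq)
  ultimately show ?thesis
    using card_mono[OF finite_nbrs[OF assms(1)], of "{p ! i, p ! Suc j}" "p ! j"] by simp
qed

text \<open>The middle one of three vertices on a path has degree at least 2, so it is never
  pendent. The criterion excludes all paths, shortest or not.\<close>

lemma general_position_middleI:
  assumes "fin_sgraph G" "R \<subseteq> verts G"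
    and "\<And>p i j k. path G p \<Longrightarrow> i < j \<Longrightarrow> j < k \<Longrightarrow> k < length p
      \<Longrightarrow> p ! i \<in> R \<Longrightarrow> p ! j \<in> R - pendent_vertices G \<Longrightarrow> p ! k \<in> R \<Longrightarrow> False"
  shows "general_position G R"
  unfolding general_position_def
proof (intro conjI notI)
  assume "\<exists>x\<in>R. \<exists>y\<in>R. \<exists>z\<in>R. x \<noteq> y \<and> y \<noteq> z \<and> x \<noteq> z \<and>
    (\<exists>p. shortest_path G p \<and> {x, y, z} \<subseteq> set p)"
  then obtain x y z p where R: "x \<in> R" "y \<in> R" "z \<in> R" and ne: "x \<noteq> y" "y \<noteq> z" "x \<noteq> z"
    and p: "shortest_path G p" "{x, y, z} \<subseteq> set p"
    by blast
  obtain i j k where *: "i < j" "j < k" "k < length p" "{p ! i, p ! j, p ! k} = {x, y, z}"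
    using three_on_path[OF ne p(2)] by metis
  have path: "path G p" using p(1) by (simp add: shortest_path_def)
  have "{p ! i, p ! j, p ! k} \<subseteq> R" using * R by simp
  moreover have "p ! j \<notin> pendent_vertices G"
    using path_interior_degree[OF assms(1) path, of j] * by (auto simp: pendent_vertices_def)
  ultimately show False using assms(3)[OF path *(1-3)] by blast
qed (fact assms(2))

lemma general_position_pendent_vertices:
  "fin_sgraph G \<Longrightarrow> general_position G (pendent_vertices G)"
  by (rule general_position_middleI) (auto simp: pendent_vertices_def)

text \<open>A path through \<open>u\<close> between two leaves would pass \<open>w\<close> on both sides of \<open>u\<close>.\<close>

lemma general_position_insert:
  assumes G: "fin_sgraph G" and S: "S \<inter> pendent_vertices G = {}"
    and w: "\<And>v. v \<in> S \<Longrightarrow> v \<noteq> w \<Longrightarrow> nbrs G v \<subseteq> S"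
    and u: "u \<in> S" "u \<in> verts G" "u \<noteq> w"
  shows "general_position G (insert u (pendent_vertices G))"
proof (rule general_position_middleI[OF G])
  fix p i j k
  assume p: "path G p" and ijk: "i < j" "j < k" "k < length p"
    and R: "p ! i \<in> insert u (pendent_vertices G)"
      "p ! j \<in> insert u (pendent_vertices G) - pendent_vertices G"
      "p ! k \<in> insert u (pendent_vertices G)"
  have inj: "p ! a = p ! b \<longleftrightarrow> a = b" if "a < length p" "b < length p" for a b
    using that p by (simp add: path_def nth_eq_iff_index_eq)
  have j: "p ! j = u" using R by blast
  have "p ! i \<noteq> p ! j" "p ! k \<noteq> p ! j" using ijk inj by auto
  \<comment> \<open>Both outer vertices differ from \<open>u\<close>, so they are pendent, and
    \<open>S\<close> contains no pendent vertex.\<close>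
  then have out: "p ! i \<notin> S" "p ! k \<notin> S" using j R S by auto
  have walk: "walk G p" using p by (simp add: path_def)
  obtain a where a: "j \<le> a" "a < k" "p ! a \<in> S" "p ! Suc a \<notin> S" "p ! Suc a \<in> nbrs G (p ! a)"
    using walk_exit[OF walk, of j k S] ijk j u(1) out(2) by auto
  \<comment> \<open>Entering \<open>S\<close> before position \<open>j\<close> is treated as leaving
    its complement.\<close>
  obtain b where b: "i \<le> b" "b < j" "p ! b \<in> - S" "p ! Suc b \<notin> - S"
      "p ! Suc b \<in> nbrs G (p ! b)"
    using walk_exit[OF walk, of i j "- S"] ijk j u(1) out(1) by auto
  have "p ! a = w" using a w by blast
  moreover have "p ! Suc b = w" using b w nbrs_sym by fastforce
  \<comment> \<open>A path visits \<open>w\<close> once, so entry and exit coincide; as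
    \<open>Suc b \<le> j \<le> a\<close>, this happens at \<open>j\<close>, where \<open>u\<close>
    sits.\<close>
  ultimately have "a = Suc b" using inj[of a "Suc b"] a b ijk by simp
  then have "a = j" using a(1) b(2) by simp
  then show False using \<open>p ! a = w\<close> j u(3) by simp
qed (use u in \<open>auto simp: pendent_vertices_def\<close>)

theorem theorem2p3:
  fixes G H :: "'a graph" and n1 n2 n3 :: nat
  assumes "unicyclic G"
    and "trimmed_form_via G n1 n2 n3 H"
  shows "(\<forall>C U. partial_sun H C U \<longrightarrow>
            int (gp G) \<ge> max 2 (int (card U)) + int n2 - int n1)
       \<and> (verts H = {} \<longrightarrow>
            int n2 - int n1 \<le> int (card (pendent_vertices G)))"
proof (intro conjI allI impI)
  let ?L = "pendent_vertices G"
  have trim: "trims_to G n1 n2 n3 H" using assms(2) by (simp add: trimmed_form_via_def)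
  have G: "fin_sgraph G" "connected_graph G" using assms(1) by (auto simp: unicyclic_def)
  have sub: "fin_sgraph H" "verts H \<subseteq> verts G" "edges H \<subseteq> edges G"
    using trims_to_subgraph[OF trim G(1)] by auto
  {
    assume "verts H = {}"
    then show "int n2 - int n1 \<le> int (card ?L)"
      \<comment> \<open>With no cycle left, the uncorrected potential is used; it is 0 on the empty
        graph.\<close>
      using trims_to_potential[OF trim G(1), of "{}"] potential_unicyclic[OF assms(1), of "{}"]
      by (simp add: potential_def)
  next
    fix C U assume sun: "partial_sun H C U"
    \<comment> \<open>Branching is measured in \<open>G\<close>; it includes \<open>U\<close>, whose
      vertices already have degree 3 in \<open>H\<close>.\<close>
    define W where "W = {v \<in> verts C. card (nbrs G v) \<ge> 3}"
    have C: "is_cycle_graph C" "verts C \<subseteq> verts H" "U \<subseteq> verts C" "edges C \<subseteq> edges H"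
      using sun by (auto simp: partial_sun_def)
    have CG: "verts C \<subseteq> verts G" using C sub by blast
    have fin: "finite (verts C)" "finite ?L" "finite W"
      using finite_verts_cycle[OF C(1)] G(1)
      by (auto simp: pendent_vertices_def fin_sgraph_def W_def)
    have bound: "int n2 - int n1 \<le> int (card ?L) - int (card W)"
      using trims_to_potential[OF trim G(1) C(2)] potential_partial_sun[OF sun]
        potential_unicyclic[OF assms(1) CG]
      by (simp add: W_def)
    have nbrs: "nbrs C v \<subseteq> nbrs G v" "nbrs H v \<subseteq> nbrs G v" for v
      using C sub by (auto simp: nbrs_def)
    have deg: "card (nbrs G v) \<ge> 2" if "v \<in> verts C" for v
      using card_mono[OF finite_nbrs[OF G(1)] nbrs(1)[of v]] cycle_degree[OF C(1) that] by simp
    have "v \<notin> ?L" if "v \<in> verts C" for v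
      using deg[OF that] by (simp add: pendent_vertices_def)
    then have disj: "verts C \<inter> ?L = {}" by blast
    have "card (nbrs G u) \<ge> 3" if "u \<in> U" for u
    proof -
      have "u \<in> verts C" using that C(3) by blast
      then have "card (nbrs H u) = 3" using partial_sun_degree[OF sun] that by simp
      then show ?thesis using card_mono[OF finite_nbrs[OF G(1)] nbrs(2)[of u]] by simp
    qed
    then have "U \<subseteq> W" using C(3) by (auto simp: W_def)
    then have UW: "card U \<le> card W" using fin by (simp add: card_mono)
    \<comment> \<open>Such a vertex has degree 2 in \<open>G\<close>, and its two cycle neighbours
      already account for that.\<close>
    have inside: "nbrs G v \<subseteq> verts C" if "v \<in> verts C" "v \<notin> W" for v
    proof -
      have "card (nbrs G v) = 2" using deg[OF that(1)] that by (simp add: W_def)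
      then have "nbrs C v = nbrs G v"
        using cycle_degree[OF C(1) that(1)] card_subset_eq[OF finite_nbrs[OF G(1)] nbrs(1)[of v]]
        by simp
      then show ?thesis using nbrs_cycle_subset[OF C(1), of v] by simp
    qed
    have gp_L: "card ?L \<le> gp G"
      by (rule gp_ge_card[OF G(1) general_position_pendent_vertices[OF G(1)]])
    \<comment> \<open>By \<open>bound\<close> and \<open>UW\<close>, it suffices that
      \<open>gp G\<close> is at least \<open>card ?L + max 2 (card W) - card W\<close>, that is, the
      number of leaves plus 2, 1 or 0 in the three cases.\<close>
    consider "card W = 0" | "card W = 1" | "card W \<ge> 2" by linarith
    then show "max 2 (int (card U)) + int n2 - int n1 \<le> int (gp G)"
    proof cases
      case 1
      then have "W = {}" using fin by simp
      obtain T where T: "T \<subseteq> verts C" "card T = 2"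
        using card_verts_cycle[OF C(1)] obtain_subset_with_card_n[of 2 "verts C"] by auto
      have "T \<subseteq> verts G" "finite T" using T(1) CG finite_subset[OF T(1) fin(1)] by blast+
      then have "general_position G T" using T(2) by (intro general_position_card_le_2) simp_all
      then have "2 \<le> gp G" using gp_ge_card[OF G(1), of T] T(2) by simp
      \<comment> \<open>Without branching vertices no edge leaves the cycle, so by connectedness no
        vertex lies off it.\<close>
      moreover have "?L = {}"
      proof (rule ccontr)
        assume "?L \<noteq> {}"
        then obtain l where "l \<in> ?L" by blast
        then have l: "l \<in> verts G" "l \<notin> verts C"
          using disj by (simp add: pendent_vertices_def, blast)
        have "T \<noteq> {}" using T(2) by fastforce
        then obtain u where u: "u \<in> verts C" "u \<in> verts G" using T(1) CG by blast
        then show False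
          using connected_graph_exit[OF G(2) u(2) l(1) u(1) l(2)] inside \<open>W = {}\<close> by blast
      qed
      ultimately show ?thesis using bound UW 1 by simp
    next
      case 2
      then obtain w where w: "W = {w}" by (rule card_1_singletonE)
      have "\<not> verts C \<subseteq> {w}"
        using card_verts_cycle[OF C(1)] card_mono[of "{w}" "verts C"] by fastforce
      then obtain u where u: "u \<in> verts C" "u \<noteq> w" by blast
      have "general_position G (insert u ?L)"
      \<comment> \<open>The set \<open>S\<close> is the cycle here, which can be left only through
        its single branching vertex \<open>w\<close>.\<close>
      proof (rule general_position_insert[OF G(1) disj])
        show "nbrs G v \<subseteq> verts C" if "v \<in> verts C" "v \<noteq> w" for v
          using inside that w by blast
      qed (use u CG in auto)
      then have "card (insert u ?L) \<le> gp G" by (rule gp_ge_card[OF G(1)])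
      moreover have "u \<notin> ?L" using u disj by blast
      ultimately have "card ?L + 1 \<le> gp G" using fin by simp
      then show ?thesis using bound UW 2 by simp
    next
      case 3
      then show ?thesis using bound UW gp_L by simp
    qed
  }
qed

end
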